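(* Let $C_1,C_2,\dots,C_m$ be closed convex sets in a real Hilbert space $H$ with non-empty intersection. Let $\Omega_1,\dots,\Omega_p$ be a list of 2-tuples in $\{(i_1,i_2): i_1,i_2\in\{1,\dots,m\},\ i_1\ne i_2\}$ with $\bigcup_{j=1}^p\Omega_j=\{1,\dots,m\}$ (i.e. every index in $\{1,\dots,m\}$ occurs in some $\Omega_j$). Let $\{(y^t,z^t,x^t)\}$ be generated, from an arbitrary $x^0\in H$, by the multiple-sets Douglas--Rachford algorithm: for each $t\in\mathbb{N}$, with $(i_1,i_2):=\Omega_{t'}$ where $t'\in\{1,\dots,p\}$ and $t'\equiv t+1\pmod p$, $$y^{t+1}:=P_{C_{i_1}}(x^t),\qquad z^{t+1}:=P_{C_{i_2}}(2y^{t+1}-x^t),\qquad x^{t+1}:=x^t+(z^{t+1}-y^{t+1}).$$ Suppose that: (a) for each $j\in\{1,\dots,p\}$, the operator $T_{\Omega_j}$ is bounded Hölder regular; (b) the collection $\{\operatorname{Fix}T_{\Omega_j}\}_{j=1}^p$ has a bounded Hölder regular intersection. Then $x^t\to\bar x$ in norm for some $\bar x\in\bigcap_{j=1}^p\operatorname{Fix}T_{\Omega_j}$ with at least a sublinear rate $O(t^{-\rho})$ for some $\rho>0$. In particular, suppose the following stronger assumptions hold: (a$'$) for each $j\in\{1,\dots,p\}$, the operator $T_{\Omega_j}$ is bounded Hölder regular with uniform exponent $\gamma_{1,j}\in(0,1]$; (b$'$) the collection $\{\operatorname{Fix}T_{\Omega_j}\}_{j=1}^p$ has a bounded Hölder regular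 intersection with uniform exponent $\gamma_2\in(0,1]$. Then there exist $M>0$ and $r\in(0,1)$ such that, for all $t\ge1$, $$\|x^t-\bar x\|\le\begin{cases}M\,t^{-\frac{\gamma}{2(1-\gamma)}}&\text{if }\gamma\in(0,1),\\ M\,r^t&\text{if }\gamma=1,\end{cases}$$ where $\gamma:=\gamma_1\gamma_2$ and $\gamma_1:=\min\{\gamma_{1,j}: 1\le j\le p\}$.
   Context: $\mathbb{N}=\{0,1,2,\dots\}$; $\operatorname{Fix}T=\{x\in H: T(x)=x\}$; $d(x,A)=\inf_{a\in A}\|x-a\|$; $P_A$ is the nearest point projection onto the closed convex set $A$ and $R_A:=2P_A-I$. The Douglas--Rachford operator for closed convex sets $C,D$ is $T_{C,D}=\frac12(I+R_DR_C)$; for $\Omega_j=(i_1,i_2)$, $T_{\Omega_j}:=T_{C_{i_1},C_{i_2}}$, so that the algorithm reads $x^{t+1}=T_{\Omega_{t'}}(x^t)$. An operator $T:H\to H$ is bounded Hölder regular if for each bounded set $K\subseteq H$ there exist $\gamma\in(0,1]$ and $\mu>0$ such that $d(x,\operatorname{Fix}T)\le\mu\|x-T(x)\|^\gamma$ for all $x\in K$. If the exponent $\gamma$ can be chosen independently of $K$, $T$ is bounded Hölder regular with uniform exponent $\gamma$. A collection $\{A_j\}_{j\in J}$ of closed convex sets with non-empty intersection has a bounded Hölder regular intersection if for each bounded set $K\subseteq H$ there exist $\gamma\in(0,1]$ and $\beta>0$ such that $d(x,\bigcap_{j\in J}A_j)\le\beta\left(\max_{j\in J}d(x,A_j)\right)^\gamma$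 for all $x\in K$. If $\gamma$ can be chosen independently of $K$, this holds with uniform exponent $\gamma$. Convergence with rate $O(t^{-\rho})$ means $\|x^t-\bar x\|\le Mt^{-\rho}$ for all $t\ge1$ and some constant $M$. *)

theory Defs
  imports "HOL-Analysis.Analysis" "HOL-Number_Theory.Cong"
begin

text \<open>
  A real Hilbert space is a type of class \<open>{real_inner, complete_space}\<close>.  The library's
  \<open>closest_point\<close> is restricted to Heine-Borel spaces and hence does not apply in
  infinite dimension; \<open>proj\<close> is the same definition without that restriction.
\<close>

definition proj :: "'a::real_inner set \<Rightarrow> 'a \<Rightarrow> 'a" where
  "proj A x = (SOME a. a \<in> A \<and> (\<forall>b\<in>A. dist x a \<le> dist x b))"

definition reflector :: "'a::real_inner set \<Rightarrow> 'a \<Rightarrow> 'a" where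
  "reflector A x = 2 *\<^sub>R proj A x - x"

definition DR_op :: "'a::real_inner set \<Rightarrow> 'a set \<Rightarrow> 'a \<Rightarrow> 'a" where
  "DR_op C D x = (1/2) *\<^sub>R (x + reflector D (reflector C x))"

definition Fix :: "('a \<Rightarrow> 'a) \<Rightarrow> 'a set" where
  "Fix T = {x. T x = x}"

text \<open>
  The distance \<open>d(x, A)\<close> is \<open>infdist x A\<close>, which is \<open>0\<close> for empty \<open>A\<close>; the definitions below
  are therefore only meaningful when \<open>Fix T\<close>, respectively the intersection of the family,
  is nonempty.  A common point of two sets is a fixed point of their Douglas-Rachford operator,
  so this is the case for Douglas-Rachford operators of sets with a common point.
\<close>

definition bounded_Holder_regular :: "('a::real_inner \<Rightarrow> 'a) \<Rightarrow> bool" where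
  "bounded_Holder_regular T \<longleftrightarrow>
     (\<forall>K. bounded K \<longrightarrow>
       (\<exists>\<gamma>\<in>{0<..1}. \<exists>\<mu>>0. \<forall>x\<in>K. infdist x (Fix T) \<le> \<mu> * norm (x - T x) powr \<gamma>))"

definition bounded_Holder_regular_uniform :: "('a::real_inner \<Rightarrow> 'a) \<Rightarrow> real \<Rightarrow> bool" where
  "bounded_Holder_regular_uniform T \<gamma> \<longleftrightarrow>
     \<gamma> \<in> {0<..1} \<and>
     (\<forall>K. bounded K \<longrightarrow>
       (\<exists>\<mu>>0. \<forall>x\<in>K. infdist x (Fix T) \<le> \<mu> * norm (x - T x) powr \<gamma>))"

text \<open>The index set \<open>J\<close> is meant to be finite and nonempty.\<close>

definition bounded_Holder_regular_inter :: "'i set \<Rightarrow> ('i \<Rightarrow> 'a::real_inner set) \<Rightarrow> bool" where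
  "bounded_Holder_regular_inter J A \<longleftrightarrow>
     (\<forall>K. bounded K \<longrightarrow>
       (\<exists>\<gamma>\<in>{0<..1}. \<exists>\<beta>>0. \<forall>x\<in>K.
          infdist x (\<Inter>j\<in>J. A j) \<le> \<beta> * (Max ((\<lambda>j. infdist x (A j)) ` J)) powr \<gamma>))"

definition bounded_Holder_regular_inter_uniform ::
    "'i set \<Rightarrow> ('i \<Rightarrow> 'a::real_inner set) \<Rightarrow> real \<Rightarrow> bool" where
  "bounded_Holder_regular_inter_uniform J A \<gamma> \<longleftrightarrow>
     \<gamma> \<in> {0<..1} \<and>
     (\<forall>K. bounded K \<longrightarrow>
       (\<exists>\<beta>>0. \<forall>x\<in>K.
          infdist x (\<Inter>j\<in>J. A j) \<le> \<beta> * (Max ((\<lambda>j. infdist x (A j)) ` J)) powr \<gamma>))"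

definition DR_tuple :: "(nat \<Rightarrow> 'a::real_inner set) \<Rightarrow> nat \<times> nat \<Rightarrow> 'a \<Rightarrow> 'a" where
  "DR_tuple C \<omega> = DR_op (C (fst \<omega>)) (C (snd \<omega>))"

text \<open>
  For \<open>p \<ge> 1\<close> exactly one \<open>j \<in> {1..p}\<close> is congruent to \<open>t + 1\<close> modulo \<open>p\<close>, so the sequences are
  determined by \<open>x 0\<close>; the values \<open>y 0\<close> and \<open>z 0\<close> play no role.
\<close>

definition multiple_sets_DR ::
    "(nat \<Rightarrow> 'a::real_inner set) \<Rightarrow> nat \<Rightarrow> (nat \<Rightarrow> nat \<times> nat)
      \<Rightarrow> (nat \<Rightarrow> 'a) \<Rightarrow> (nat \<Rightarrow> 'a) \<Rightarrow> (nat \<Rightarrow> 'a) \<Rightarrow> bool" where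
  "multiple_sets_DR C p \<Omega> y z x \<longleftrightarrow>
     (\<forall>t. \<forall>j\<in>{1..p}. [j = t + 1] (mod p) \<longrightarrow>
        y (t + 1) = proj (C (fst (\<Omega> j))) (x t) \<and>
        z (t + 1) = proj (C (snd (\<Omega> j))) (2 *\<^sub>R y (t + 1) - x t) \<and>
        x (t + 1) = x t + (z (t + 1) - y (t + 1)))"

end

theory Submission
  imports Defs
begin

text \<open>
  Let \<open>F\<close> be the common fixed point set and \<open>d t\<close> the distance of \<open>x t\<close> to \<open>F\<close>.  Firm
  nonexpansiveness gives \<open>\<parallel>x (t+1) - f\<parallel>\<^sup>2 + \<parallel>x (t+1) - x t\<parallel>\<^sup>2 \<le> \<parallel>x t - f\<parallel>\<^sup>2\<close> for every \<open>f\<close> in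
  \<open>F\<close>; taking the infimum over \<open>f\<close>, the energy \<open>s\<close> of a full cycle of \<open>p\<close> steps satisfies
  \<open>s \<le> (d t)\<^sup>2 - (d (t+p))\<^sup>2\<close>, and \<open>\<parallel>x t - xbar\<parallel> \<le> 2 d t\<close>.  During the cycle each
  operator is applied once, at a point within \<open>p sqrt s\<close> of \<open>x t\<close>, so the two regularity
  assumptions bound \<open>d t\<close> by a multiple of \<open>(sqrt s) powr \<gamma>\<close>.  Hence \<open>a n = (d (n p))\<^sup>2\<close> obeys
  \<open>a n \<le> K (a n - a (n+1)) powr \<gamma>\<close>, which forces \<open>a n = O(n powr (- \<gamma> / (1 - \<gamma>)))\<close>, or geometric
  decay when \<open>\<gamma> = 1\<close>.
\<close>

section \<open>Projections and Douglas-Rachford operators in Hilbert space\<close>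

text \<open>A minimising sequence is Cauchy by the parallelogram identity. This is phrased with the
  nested closed sets \<open>S n\<close> of near-minimisers, whose diameters shrink to 0, so that
  completeness yields a common point.\<close>

lemma closest_point_exists_convex_complete:
  fixes A :: "'a::{real_inner, complete_space} set"
  assumes "closed A" "convex A" "A \<noteq> {}"
  shows "\<exists>a\<in>A. \<forall>b\<in>A. dist x a \<le> dist x b"
proof -
  define d where "d = infdist x A"
  define S where "S n = A \<inter> cball x (d + inverse (real (Suc n)))" for n
  have d0: "d \<ge> 0" by (simp add: d_def infdist_nonneg)
  have d_le: "d \<le> dist x a" if "a \<in> A" for a
    using that by (simp add: d_def infdist_le)
  \<comment> \<open>The midpoint of \<open>a\<close> and \<open>b\<close> stays in \<open>A\<close>,
    hence at distance at least \<open>d\<close> from \<open>x\<close>; the parallelogram identity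
    then limits how far apart near-minimisers can be.\<close>
  have mid: "(dist a b)\<^sup>2 \<le> 4 * ((d + e)\<^sup>2 - d\<^sup>2)"
    if ab: "a \<in> A" "b \<in> A" "dist x a \<le> d + e" "dist x b \<le> d + e" for a b e
  proof -
    have "(1/2) *\<^sub>R a + (1/2) *\<^sub>R b \<in> A"
      using convexD[OF assms(2) ab(1,2), of "1/2" "1/2"] by simp
    then have "d \<le> norm (x - ((1/2) *\<^sub>R a + (1/2) *\<^sub>R b))"
      using d_le by (simp add: dist_norm)
    then have 1: "d\<^sup>2 \<le> (norm (x - ((1/2) *\<^sub>R a + (1/2) *\<^sub>R b)))\<^sup>2"
      using d0 by (intro power_mono) auto
    have 2: "(norm (x - a))\<^sup>2 \<le> (d + e)\<^sup>2" "(norm (x - b))\<^sup>2 \<le> (d + e)\<^sup>2"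
      using ab by (auto simp: dist_norm intro!: power_mono)
    have "(norm (a - b))\<^sup>2 = 2 * (norm (x - a))\<^sup>2 + 2 * (norm (x - b))\<^sup>2
        - 4 * (norm (x - ((1/2) *\<^sub>R a + (1/2) *\<^sub>R b)))\<^sup>2"
      unfolding power2_norm_eq_inner
      by (simp add: inner_diff inner_add inner_commute algebra_simps)
    with 1 2 show ?thesis by (simp add: dist_norm)
  qed
  obtain a where a: "\<And>n. a \<in> S n"
  proof (rule decreasing_closed_nest[of S])
    show "closed (S n)" for n
      by (simp add: S_def assms closed_Int)
    show "S n \<noteq> {}" for n
    proof -
      have "\<exists>a\<in>A. dist x a < d + inverse (real (Suc n))"
        using assms(3) infdist_notempty[OF assms(3), of x]
          cInf_lessD[of "dist x ` A" "d + inverse (real (Suc n))"]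
        by (auto simp: d_def)
      then show ?thesis by (force simp: S_def)
    qed
    show "S n \<subseteq> S m" if "m \<le> n" for m n
    proof -
      have "inverse (real (Suc n)) \<le> inverse (real (Suc m))"
        using that by (intro le_imp_inverse_le) auto
      then have "cball x (d + inverse (real (Suc n))) \<subseteq> cball x (d + inverse (real (Suc m)))"
        by (intro subset_cball) simp
      then show ?thesis unfolding S_def by blast
    qed
    show "\<exists>n. \<forall>a\<in>S n. \<forall>b\<in>S n. dist a b < \<epsilon>" if "\<epsilon> > 0" for \<epsilon>
    proof -
      have "(\<lambda>n. 4 * ((d + inverse (real (Suc n)))\<^sup>2 - d\<^sup>2)) \<longlonglongrightarrow> 4 * ((d + 0)\<^sup>2 - d\<^sup>2)"
        by (intro tendsto_mult tendsto_diff tendsto_power tendsto_add tendsto_const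
            LIMSEQ_inverse_real_of_nat)
      then have "\<forall>\<^sub>F n in sequentially. 4 * ((d + inverse (real (Suc n)))\<^sup>2 - d\<^sup>2) < \<epsilon>\<^sup>2"
        using that by (intro order_tendstoD(2)) auto
      then obtain n where n: "4 * ((d + inverse (real (Suc n)))\<^sup>2 - d\<^sup>2) < \<epsilon>\<^sup>2"
        using eventually_happens'[OF sequentially_bot] by blast
      have "dist a b < \<epsilon>" if ab: "a \<in> S n" "b \<in> S n" for a b
      proof (rule power_less_imp_less_base)
        have "(dist a b)\<^sup>2 \<le> 4 * ((d + inverse (real (Suc n)))\<^sup>2 - d\<^sup>2)"
          using ab unfolding S_def by (intro mid) auto
        also note n
        finally show "(dist a b)\<^sup>2 < \<epsilon>\<^sup>2" .
      qed (use \<open>\<epsilon> > 0\<close> in simp)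
      then show ?thesis by blast
    qed
  qed blast
  have "dist x a \<le> d"
  proof (rule LIMSEQ_le_const)
    show "(\<lambda>n. d + inverse (real (Suc n))) \<longlonglongrightarrow> d"
      using tendsto_add[OF tendsto_const[of d] LIMSEQ_inverse_real_of_nat] by simp
    show "\<exists>N. \<forall>n\<ge>N. dist x a \<le> d + inverse (real (Suc n))"
      using a by (auto simp: S_def)
  qed
  moreover have "a \<in> A" using a[of 0] by (simp add: S_def)
  ultimately show ?thesis using d_le by (meson order_trans)
qed

lemma proj_closest:
  fixes A :: "'a::{real_inner, complete_space} set"
  assumes "closed A" "convex A" "A \<noteq> {}"
  shows "proj A x \<in> A" and "\<forall>b\<in>A. dist x (proj A x) \<le> dist x b"
  using someI_ex[OF closest_point_exists_convex_complete[OF assms, of x, unfolded Bex_def]]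
  unfolding proj_def by blast+

lemma proj_eq_self:
  fixes A :: "'a::{real_inner, complete_space} set"
  assumes "closed A" "convex A" "x \<in> A"
  shows "proj A x = x"
  using proj_closest(2)[of A x] assms by fastforce

text \<open>With u = x - y and q the difference of the projections, the two obtuse-angle
  inequalities add up to |q|^2 <= <u, q>, and |2q - u|^2 = |u|^2 + 4(|q|^2 - <u, q>).\<close>

lemma reflector_nonexpansive:
  fixes A :: "'a::{real_inner, complete_space} set"
  assumes "closed A" "convex A" "A \<noteq> {}"
  shows "norm (reflector A x - reflector A y) \<le> norm (x - y)"
proof -
  note P = proj_closest[OF assms]
  have "(x - proj A x) \<bullet> (proj A y - proj A x) \<le> 0" "(y - proj A y) \<bullet> (proj A x - proj A y) \<le> 0"
    using P by (auto intro!: any_closest_point_dot[OF assms(2,1)])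
  then have "(norm (reflector A x - reflector A y))\<^sup>2 \<le> (norm (x - y))\<^sup>2"
    unfolding reflector_def power2_norm_eq_inner
    by (simp add: inner_diff inner_add inner_commute algebra_simps)
  then show ?thesis by (simp add: power_mono_iff)
qed

text \<open>The operator averages the identity with a nonexpansive map, so the two differences are
  (u + v)/2 and (u - v)/2; their squares add up to the mean of |u|^2 and |v|^2.\<close>

lemma DR_op_firmly_nonexpansive:
  fixes C D :: "'a::{real_inner, complete_space} set"
  assumes "closed C" "convex C" "C \<noteq> {}" "closed D" "convex D" "D \<noteq> {}"
  shows "(norm (DR_op C D x - DR_op C D y))\<^sup>2
      + (norm ((x - DR_op C D x) - (y - DR_op C D y)))\<^sup>2 \<le> (norm (x - y))\<^sup>2"
proof -
  define u where "u = x - y"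
  define v where "v = reflector D (reflector C x) - reflector D (reflector C y)"
  have "norm v \<le> norm u"
    unfolding u_def v_def by (intro order_trans[OF reflector_nonexpansive reflector_nonexpansive] assms)
  then have "((norm u)\<^sup>2 + (norm v)\<^sup>2) / 2 \<le> (norm u)\<^sup>2"
    using power_mono[of "norm v" "norm u" 2] by simp
  moreover have "DR_op C D x - DR_op C D y = (1/2) *\<^sub>R (u + v)"
    by (simp add: DR_op_def u_def v_def algebra_simps)
  moreover have "x - DR_op C D x - (y - DR_op C D y) = (1/2) *\<^sub>R (u - v)"
    using scaleR_half_double[of x] scaleR_half_double[of y]
    by (simp add: DR_op_def u_def v_def algebra_simps)
  moreover have "(norm ((1/2) *\<^sub>R (u + v)))\<^sup>2 + (norm ((1/2) *\<^sub>R (u - v)))\<^sup>2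
      = ((norm u)\<^sup>2 + (norm v)\<^sup>2) / 2"
    unfolding power2_norm_eq_inner
    by (simp add: inner_diff inner_add inner_commute algebra_simps)
  ultimately show ?thesis unfolding u_def by (simp only:)
qed

lemma closed_Fix_DR_op:
  fixes C D :: "'a::{real_inner, complete_space} set"
  assumes "closed C" "convex C" "C \<noteq> {}" "closed D" "convex D" "D \<noteq> {}"
  shows "closed (Fix (DR_op C D))"
proof -
  have nonexp: "(dist (DR_op C D x) (DR_op C D y))\<^sup>2 \<le> (dist x y)\<^sup>2" for x y
    using DR_op_firmly_nonexpansive[OF assms, of x y]
      zero_le_power2[of "norm ((x - DR_op C D x) - (y - DR_op C D y))"]
    unfolding dist_norm by linarith
  have "continuous_on UNIV (DR_op C D)"
    using nonexp by (intro lipschitz_on_continuous_on[of 1] lipschitz_onI)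
      (auto simp: power_mono_iff)
  then show ?thesis
    unfolding Fix_def by (intro closed_Collect_eq continuous_on_id)
qed

text \<open>Both reflectors fix a common point. This makes the common fixed point set nonempty, so
  that \<open>infdist\<close> to it is a genuine distance.\<close>

lemma Int_subset_Fix_DR_op:
  fixes C D :: "'a::{real_inner, complete_space} set"
  assumes "closed C" "convex C" "closed D" "convex D"
  shows "C \<inter> D \<subseteq> Fix (DR_op C D)"
  using assms by (auto simp: Fix_def DR_op_def reflector_def proj_eq_self scaleR_2)

lemma DR_op_eq_step:
  fixes x :: "'a::real_inner"
  shows "DR_op C D x = x + (proj D (2 *\<^sub>R proj C x - x) - proj C x)"
  using scaleR_half_double[of x] by (simp add: DR_op_def reflector_def algebra_simps)

section \<open>Fejer monotone sequences\<close>

text \<open>At a fixed point the residual term of firm nonexpansiveness is the step length itself.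
  Only distances remain, and the operator may change from step to step as long as each one fixes
  every point of \<open>F\<close>.\<close>

locale fejer_steps =
  fixes x :: "nat \<Rightarrow> 'a::metric_space" and F :: "'a set"
  assumes F_nonempty: "F \<noteq> {}"
    and step: "f \<in> F \<Longrightarrow> (dist (x (Suc t)) f)\<^sup>2 + (dist (x (Suc t)) (x t))\<^sup>2 \<le> (dist (x t) f)\<^sup>2"
begin

abbreviation path_energy :: "nat \<Rightarrow> nat \<Rightarrow> real" where
  "path_energy s k \<equiv> (\<Sum>i<k. (dist (x (Suc (s + i))) (x (s + i)))\<^sup>2)"

lemma dist_path_energy:
  assumes "f \<in> F"
  shows "(dist (x (s + k)) f)\<^sup>2 + path_energy s k \<le> (dist (x s) f)\<^sup>2"
proof (induction k)
  case (Suc k)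
  then show ?case using step[OF assms, of "s + k"] by simp
qed simp

text \<open>Replaces the choice of a nearest point of \<open>F\<close>, which need not exist here:
  bounds valid for every \<open>f\<close> pass to the infimum.\<close>

lemma infdist_greatest: "(\<And>f. f \<in> F \<Longrightarrow> c \<le> dist a f) \<Longrightarrow> c \<le> infdist a F"
  using F_nonempty by (simp add: infdist_notempty cINF_greatest)

lemma infdist_path_energy:
  "(infdist (x (s + k)) F)\<^sup>2 + path_energy s k \<le> (infdist (x s) F)\<^sup>2"
proof -
  \<comment> \<open>The square root makes the upper bound linear in the distance, the form that
    \<open>infdist_greatest\<close> handles.\<close>
  have "sqrt ((infdist (x (s + k)) F)\<^sup>2 + path_energy s k) \<le> infdist (x s) F"
  proof (rule infdist_greatest)
    fix f assume f: "f \<in> F"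
    have "(infdist (x (s + k)) F)\<^sup>2 \<le> (dist (x (s + k)) f)\<^sup>2"
      using infdist_le[OF f] by (intro power_mono) (auto simp: infdist_nonneg)
    then have "(infdist (x (s + k)) F)\<^sup>2 + path_energy s k \<le> (dist (x s) f)\<^sup>2"
      using dist_path_energy[OF f, of s k] by linarith
    then show "sqrt ((infdist (x (s + k)) F)\<^sup>2 + path_energy s k) \<le> dist (x s) f"
      by (rule real_le_lsqrt[OF zero_le_dist])
  qed
  then show ?thesis by (rule sqrt_le_D)
qed

lemma infdist_antimono: "s \<le> t \<Longrightarrow> infdist (x t) F \<le> infdist (x s) F"
proof -
  assume "s \<le> t"
  then have "(infdist (x t) F)\<^sup>2 + path_energy s (t - s) \<le> (infdist (x s) F)\<^sup>2"
    using infdist_path_energy[of s "t - s"] by simp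
  moreover have "0 \<le> path_energy s (t - s)" by (simp add: sum_nonneg)
  ultimately have "(infdist (x t) F)\<^sup>2 \<le> (infdist (x s) F)\<^sup>2" by linarith
  then show ?thesis by (simp add: power_mono_iff infdist_nonneg)
qed

text \<open>Neither iterate is farther from a point \<open>f\<close> of \<open>F\<close> than
  \<open>x s\<close> is; the triangle inequality through \<open>f\<close> gives the factor
  2.\<close>

lemma dist_iterates_le: "s \<le> t \<Longrightarrow> dist (x t) (x s) \<le> 2 * infdist (x s) F"
proof -
  assume st: "s \<le> t"
  have "dist (x t) (x s) / 2 \<le> infdist (x s) F"
  proof (rule infdist_greatest)
    fix f assume f: "f \<in> F"
    have "0 \<le> path_energy s (t - s)" by (simp add: sum_nonneg)
    moreover have "(dist (x t) f)\<^sup>2 + path_energy s (t - s) \<le> (dist (x s) f)\<^sup>2"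
      using dist_path_energy[OF f, of s "t - s"] st by simp
    ultimately have "(dist (x t) f)\<^sup>2 \<le> (dist (x s) f)\<^sup>2" by linarith
    then have "dist (x t) f \<le> dist (x s) f" by (simp add: power_mono_iff)
    then show "dist (x t) (x s) / 2 \<le> dist (x s) f"
      using dist_triangle2[of "x t" "x s" f] by linarith
  qed
  then show ?thesis by simp
qed

lemma bounded_range: "bounded (range x)"
  unfolding bounded_any_center[of _ "x 0"]
  using dist_iterates_le[of 0] by (auto simp: dist_commute intro!: exI[of _ "2 * infdist (x 0) F"])

lemma path_length_le:
  "dist (x s) (x (s + k)) \<le> k * sqrt (path_energy s m)" if "k \<le> m"
  using that
proof (induction k)
  case (Suc k)
  have "(dist (x (Suc (s + k))) (x (s + k)))\<^sup>2 \<le> path_energy s m"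
    using Suc.prems
    by (intro member_le_sum[of k "{..<m}" "\<lambda>i. (dist (x (Suc (s + i))) (x (s + i)))\<^sup>2"]) auto
  then have "dist (x (Suc (s + k))) (x (s + k)) \<le> sqrt (path_energy s m)"
    by (simp add: real_le_rsqrt)
  moreover have "dist (x s) (x (s + Suc k)) \<le> dist (x s) (x (s + k)) + dist (x (Suc (s + k))) (x (s + k))"
    by (metis add_Suc_right dist_commute dist_triangle)
  ultimately show ?case using Suc by (simp add: algebra_simps)
qed simp

end

text \<open>By \<open>dist_iterates_le\<close> the tail after each index stays in a ball of radius
  twice the distance to \<open>F\<close>. This gives the Cauchy property and, on letting the later
  index tend to infinity, transfers any rate for \<open>infdist\<close> to the iterates.\<close>

lemma fejer_steps_converges:
  fixes x :: "nat \<Rightarrow> 'a::complete_space"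
  assumes "fejer_steps x F" "closed F" and lim: "(\<lambda>t. infdist (x t) F) \<longlonglongrightarrow> 0"
  shows "\<exists>l\<in>F. x \<longlonglongrightarrow> l \<and> (\<forall>t. dist (x t) l \<le> 2 * infdist (x t) F)"
proof -
  interpret fejer_steps x F by fact
  have "Cauchy x"
    unfolding Cauchy_altdef
  proof (intro allI impI)
    fix e :: real assume "e > 0"
    then have "\<forall>\<^sub>F t in sequentially. infdist (x t) F < e / 2"
      using lim by (intro order_tendstoD(2)) auto
    then obtain N where "\<And>t. t \<ge> N \<Longrightarrow> infdist (x t) F < e / 2"
      by (auto simp: eventually_sequentially)
    then show "\<exists>M. \<forall>m\<ge>M. \<forall>n>m. dist (x m) (x n) < e"
      by (intro exI[of _ N]) (smt (verit) dist_commute dist_iterates_le field_sum_of_halves less_imp_le)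
  qed
  then obtain l where l: "x \<longlonglongrightarrow> l"
    using Cauchy_convergent_iff convergent_def by metis
  have "infdist l F = 0"
    using lim tendsto_infdist[OF l, of F] LIMSEQ_unique by blast
  then have "l \<in> F"
    using in_closed_iff_infdist_zero[OF \<open>closed F\<close> F_nonempty] by simp
  moreover have "dist (x t) l \<le> 2 * infdist (x t) F" for t
  proof (rule LIMSEQ_le_const2)
    show "(\<lambda>n. dist (x t) (x n)) \<longlonglongrightarrow> dist (x t) l"
      by (intro tendsto_intros l)
    show "\<exists>N. \<forall>n\<ge>N. dist (x t) (x n) \<le> 2 * infdist (x t) F"
      using dist_iterates_le by (metis dist_commute)
  qed
  ultimately show ?thesis using l by blast
qed

section \<open>The scalar recurrence\<close>

text \<open>Inverting the power gives a decrease of at least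
  \<open>c * a n powr (1 + \<theta>)\<close>, a discrete form of a' = -c a^(1 + \<theta>). As for
  that equation, \<open>a n powr (- \<theta>)\<close> grows at least linearly.\<close>

lemma powr_recurrence_rate:
  fixes a :: "nat \<Rightarrow> real"
  assumes "0 < K" "0 < \<gamma>" "\<gamma> < 1"
    and nonneg: "\<And>n. 0 \<le> a n" and dec: "\<And>n. a (Suc n) \<le> a n"
    and rec: "\<And>n. a n \<le> K * (a n - a (Suc n)) powr \<gamma>"
  shows "\<exists>M>0. \<forall>n. a n \<le> M * real (Suc n) powr (- (\<gamma> / (1 - \<gamma>)))"
proof -
  define \<theta> where "\<theta> = (1 - \<gamma>) / \<gamma>"
  have \<theta>: "\<theta> > 0" "1 + \<theta> = 1 / \<gamma>" "\<gamma> / (1 - \<gamma>) = 1 / \<theta>"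
    using assms by (auto simp: \<theta>_def field_simps)
  define c where "c = K powr (- (1 / \<gamma>))"
  have c: "c > 0" using assms by (simp add: c_def)
  have drop: "c * a n powr (1 + \<theta>) \<le> a n - a (Suc n)" for n
  proof -
    have "a n powr (1 / \<gamma>) \<le> (K * (a n - a (Suc n)) powr \<gamma>) powr (1 / \<gamma>)"
      using assms by (intro powr_mono2) auto
    also have "\<dots> = K powr (1 / \<gamma>) * (a n - a (Suc n))"
      using assms dec[of n] by (simp add: powr_mult powr_powr)
    finally show ?thesis
      using assms by (simp add: \<theta> c_def powr_minus field_simps)
  qed
  \<comment> \<open>Convexity of \<open>s \<mapsto> s powr (- \<theta>)\<close> turns the recurrence into a linear lower bound.\<close>
  have grow: "a n powr (- \<theta>) + \<theta> * c \<le> a (Suc n) powr (- \<theta>)" if "a (Suc n) > 0" for n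
  proof -
    have an: "a n > 0" using that dec[of n] by linarith
    \<comment> \<open>Dividing by \<open>a n\<close> reduces the convexity inequality to its tangent
      at 1, which follows from the tangents of \<open>ln\<close> and \<open>exp\<close>.\<close>
    define u where "u = a (Suc n) / a n"
    have u: "u > 0" using an that by (simp add: u_def)
    have "\<theta> * ln u \<le> \<theta> * (u - 1)"
      using \<theta> ln_le_minus_one[OF u] by (intro mult_left_mono) auto
    then have "1 + \<theta> * (1 - u) \<le> 1 + (- \<theta> * ln u)"
      by (simp add: algebra_simps)
    also have "\<dots> \<le> u powr (- \<theta>)"
      using u exp_ge_add_one_self[of "- \<theta> * ln u"] by (simp add: powr_def)
    finally have "a n powr (- \<theta>) * (1 + \<theta> * (1 - u)) \<le> a n powr (- \<theta>) * u powr (- \<theta>)"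
      by (intro mult_left_mono) auto
    also have "\<dots> = (a n * u) powr (- \<theta>)"
      using an u by (simp add: powr_mult)
    also have "a n * u = a (Suc n)" using an by (simp add: u_def)
    finally have "a n powr (- \<theta>) + \<theta> * (a n powr (- \<theta>) * (1 - u)) \<le> a (Suc n) powr (- \<theta>)"
      by (simp add: algebra_simps)
    moreover have "c \<le> a n powr (- \<theta>) * (1 - u)"
    proof -
      have "c * a n powr \<theta> * a n = c * a n powr (1 + \<theta>)"
        using an by (simp add: powr_add)
      also have "\<dots> \<le> (1 - u) * a n"
        using drop[of n] an by (simp add: u_def left_diff_distrib)
      finally have "c * a n powr \<theta> * a n \<le> (1 - u) * a n" .
      then have "c * a n powr \<theta> \<le> 1 - u" using an by simp
      then show ?thesis using an by (simp add: powr_minus field_simps)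
    qed
    ultimately show ?thesis
      using \<theta> mult_left_mono[of c "a n powr (- \<theta>) * (1 - u)" \<theta>] by linarith
  qed
  \<comment> \<open>The minimum covers both the start of the induction and its increments; the 1
    only keeps \<open>b\<close> positive when the sequence is identically 0.\<close>
  define b where "b = min (\<theta> * c) (if a 0 > 0 then a 0 powr (- \<theta>) else 1)"
  have b: "b > 0" using \<theta> c by (auto simp: b_def)
  have lower: "real (Suc n) * b \<le> a n powr (- \<theta>)" if "a n > 0" for n
    using that
  proof (induction n)
    case 0
    then show ?case by (simp add: b_def)
  next
    case (Suc n)
    then have "real (Suc n) * b \<le> a n powr (- \<theta>)" using dec[of n] by simp
    moreover have "b \<le> \<theta> * c" by (simp add: b_def)
    ultimately have "real (Suc n) * b + b \<le> a (Suc n) powr (- \<theta>)"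
      using grow[OF Suc.prems] by linarith
    then show ?case by (simp add: algebra_simps)
  qed
  have "a n \<le> b powr (- (1 / \<theta>)) * real (Suc n) powr (- (1 / \<theta>))" for n
  proof (cases "a n > 0")
    case True
    have "(a n powr (- \<theta>)) powr (- (1 / \<theta>)) \<le> (real (Suc n) * b) powr (- (1 / \<theta>))"
      using lower[OF True] b \<theta> by (intro powr_mono2') auto
    then show ?thesis using True \<theta> b by (simp add: powr_powr powr_mult mult.commute)
  next
    case False
    then show ?thesis using b nonneg[of n] by (smt (verit) mult_nonneg_nonneg powr_ge_zero)
  qed
  then show ?thesis using b \<theta> by (intro exI[of _ "b powr (- (1 / \<theta>))"]) auto
qed

lemma linear_recurrence_rate:
  fixes a :: "nat \<Rightarrow> real"
  assumes nonneg: "\<And>n. 0 \<le> a n" and dec: "\<And>n. a (Suc n) \<le> a n"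
    and rec: "\<And>n. a n \<le> K * (a n - a (Suc n))"
  shows "\<exists>q\<in>{0<..<1}. \<forall>n. a n \<le> a 0 * q ^ n"
proof -
  \<comment> \<open>Enlarging the constant to at least 2 keeps \<open>q\<close> strictly between 0
    and 1 whatever \<open>K\<close> is.\<close>
  define L where "L = max K 2"
  define q where "q = 1 - 1 / L"
  have q: "q \<in> {0<..<1}" by (auto simp: q_def L_def max_def field_simps)
  have step: "a (Suc n) \<le> q * a n" for n
  proof -
    have "K * (a n - a (Suc n)) \<le> L * (a n - a (Suc n))"
      using dec[of n] by (intro mult_right_mono) (auto simp: L_def)
    then have "a n \<le> L * (a n - a (Suc n))" using rec[of n] by linarith
    then show ?thesis by (simp add: q_def L_def field_simps max_def split: if_splits)
  qed
  have "a n \<le> a 0 * q ^ n" for n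
  proof (induction n)
    case (Suc n)
    then have "q * a n \<le> q * (a 0 * q ^ n)" using q by (intro mult_left_mono) auto
    then show ?case using step[of n] by (simp add: mult.left_commute)
  qed simp
  with q show ?thesis by blast
qed

section \<open>Convergence rates from Hoelder regularity\<close>

text \<open>Brings the different exponents of the operators down to their minimum; on a bounded
  range this costs only the factor \<open>B\<close>.\<close>

lemma powr_le_lower_exponent:
  fixes \<sigma> B :: real
  assumes "0 \<le> \<sigma>" "\<sigma> \<le> B" "1 \<le> B" "\<gamma> \<le> \<gamma>'" "\<gamma>' \<le> 1" "0 \<le> \<gamma>"
  shows "\<sigma> powr \<gamma>' \<le> B * \<sigma> powr \<gamma>"
proof -
  have "\<sigma> powr (\<gamma>' - \<gamma>) \<le> B powr (\<gamma>' - \<gamma>)"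
    using assms by (intro powr_mono2) auto
  also have "\<dots> \<le> B powr 1" using assms by (intro powr_mono) auto
  finally have "\<sigma> powr (\<gamma>' - \<gamma>) \<le> B" using assms by simp
  then have "\<sigma> powr (\<gamma>' - \<gamma>) * \<sigma> powr \<gamma> \<le> B * \<sigma> powr \<gamma>" by (intro mult_right_mono) auto
  then show ?thesis by (simp flip: powr_add)
qed

context fejer_steps
begin

text \<open>Regularity of the operator with index \<open>j\<close> is used at the iterate where it
  acts, and the bound is carried back to the start of the cycle along the path. All bounds are in
  terms of the root \<sigma> of the cycle energy.\<close>

lemma cycle_recurrence:
  fixes G :: "nat \<Rightarrow> 'a set"
  assumes p: "p \<ge> 1"
    and exps: "\<And>j. j \<in> {1..p} \<Longrightarrow> \<gamma>1 j \<in> {0<..1}" "\<gamma>2 \<in> {0<..1}"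
    and pos: "\<And>j. j \<in> {1..p} \<Longrightarrow> \<mu> j > 0" "\<beta> > 0"
    and reg: "\<And>t j. j = t mod p + 1 \<Longrightarrow>
      infdist (x t) (G j) \<le> \<mu> j * dist (x (Suc t)) (x t) powr \<gamma>1 j"
    and inter: "\<And>t. infdist (x t) F \<le> \<beta> * Max ((\<lambda>j. infdist (x t) (G j)) ` {1..p}) powr \<gamma>2"
  shows "\<exists>K>0. \<forall>n. (infdist (x (n * p)) F)\<^sup>2
    \<le> K * ((infdist (x (n * p)) F)\<^sup>2 - (infdist (x (Suc n * p)) F)\<^sup>2) powr (Min (\<gamma>1 ` {1..p}) * \<gamma>2)"
proof -
  define g where "g = Min (\<gamma>1 ` {1..p})"
  have g: "g \<in> \<gamma>1 ` {1..p}" unfolding g_def using p by (intro Min_in) auto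
  then have g01: "0 < g" "g \<le> 1" using exps(1) by auto
  have g_le: "g \<le> \<gamma>1 j" if "j \<in> {1..p}" for j
    using that by (simp add: g_def)
  \<comment> \<open>Bounds \<sigma> for every cycle, and is at least 1 as
    \<open>powr_le_lower_exponent\<close> requires.\<close>
  define B where "B = max 1 (infdist (x 0) F)"
  define m where "m = (\<Sum>j\<in>{1..p}. \<mu> j)"
  have m: "0 \<le> m" "\<And>j. j \<in> {1..p} \<Longrightarrow> \<mu> j \<le> m"
    using pos(1) unfolding m_def
    by (auto intro!: sum_nonneg member_le_sum simp: less_imp_le)
  \<comment> \<open>The summand \<open>m\<close> comes from regularity, \<open>p\<close> from the
    way back to the start of the cycle, and \<open>B\<close> from lowering the exponents to
    \<open>g\<close>.\<close>
  define c where "c = (real p + m) * B"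
  have c: "c > 0" using p m by (auto simp: c_def B_def intro!: mult_pos_pos)
  define K where "K = (\<beta> * c powr \<gamma>2)\<^sup>2"
  have "K > 0" using c pos(2) by (simp add: K_def)
  moreover have "(infdist (x (n * p)) F)\<^sup>2
      \<le> K * ((infdist (x (n * p)) F)\<^sup>2 - (infdist (x (Suc n * p)) F)\<^sup>2) powr (g * \<gamma>2)" for n
  proof -
    define s where "s = n * p"
    define \<sigma> where "\<sigma> = sqrt (path_energy s p)"
    have e0: "0 \<le> path_energy s p" by (simp add: sum_nonneg)
    have \<sigma>0: "0 \<le> \<sigma>" using e0 by (simp add: \<sigma>_def)
    have energy: "path_energy s p \<le> (infdist (x s) F)\<^sup>2 - (infdist (x (s + p)) F)\<^sup>2"
      using infdist_path_energy[of s p] by linarith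
    also have "\<dots> \<le> (infdist (x s) F)\<^sup>2" by simp
    finally have "\<sigma> \<le> infdist (x s) F"
      unfolding \<sigma>_def by (intro real_le_lsqrt) (auto simp: infdist_nonneg)
    also have "\<dots> \<le> B" using infdist_antimono[of 0 s] by (simp add: B_def)
    finally have \<sigma>B: "\<sigma> \<le> B" .
    have G_bound: "infdist (x s) (G j) \<le> c * \<sigma> powr g" if j: "j \<in> {1..p}" for j
    proof -
      define k where "k = j - 1"
      have k: "k < p" "j = k + 1" using j by (auto simp: k_def)
      \<comment> \<open>As \<open>s\<close> is a multiple of \<open>p\<close>, the operator with
        index \<open>j\<close> acts at offset \<open>j - 1\<close> of the cycle.\<close>
      then have j_eq: "j = (s + k) mod p + 1" by (simp add: s_def)
      have "(dist (x (Suc (s + k))) (x (s + k)))\<^sup>2 \<le> path_energy s p"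
        using k by (intro member_le_sum[of k "{..<p}" "\<lambda>i. (dist (x (Suc (s + i))) (x (s + i)))\<^sup>2"]) auto
      then have step_le: "dist (x (Suc (s + k))) (x (s + k)) \<le> \<sigma>"
        by (simp add: \<sigma>_def real_le_rsqrt)
      have "infdist (x (s + k)) (G j) \<le> \<mu> j * dist (x (Suc (s + k))) (x (s + k)) powr \<gamma>1 j"
        by (rule reg[OF j_eq])
      also have "\<dots> \<le> m * \<sigma> powr \<gamma>1 j"
        using m j pos(1)[OF j] exps(1)[OF j] step_le by (intro mult_mono powr_mono2) auto
      also have "\<dots> \<le> m * (B * \<sigma> powr g)"
        using m \<sigma>0 \<sigma>B exps(1)[OF j] g_le[OF j] g01
        by (intro mult_left_mono powr_le_lower_exponent) (auto simp: B_def)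
      finally have 1: "infdist (x (s + k)) (G j) \<le> m * (B * \<sigma> powr g)" .
      have "dist (x s) (x (s + k)) \<le> k * \<sigma>"
        unfolding \<sigma>_def using k by (intro path_length_le) simp
      also have "\<dots> \<le> p * \<sigma>" using k \<sigma>0 by (intro mult_right_mono) auto
      also have "\<dots> \<le> p * (B * \<sigma> powr g)"
        using powr_le_lower_exponent[of \<sigma> B g 1] \<sigma>0 \<sigma>B g01
        by (intro mult_left_mono) (auto simp: B_def)
      finally have 2: "dist (x s) (x (s + k)) \<le> p * (B * \<sigma> powr g)" .
      show ?thesis
        using infdist_triangle[of "x s" "G j" "x (s + k)"] 1 2
        by (simp add: c_def algebra_simps)
    qed
    define N where "N = Max ((\<lambda>j. infdist (x s) (G j)) ` {1..p})"
    have "N \<in> (\<lambda>j. infdist (x s) (G j)) ` {1..p}"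
      unfolding N_def using p by (intro Max_in) auto
    then have N: "0 \<le> N" "N \<le> c * \<sigma> powr g"
      using G_bound by (auto simp: infdist_nonneg)
    have "infdist (x s) F \<le> \<beta> * N powr \<gamma>2"
      using inter[of s] by (simp add: N_def)
    also have "\<dots> \<le> \<beta> * (c * \<sigma> powr g) powr \<gamma>2"
      using N pos(2) exps(2) by (intro mult_left_mono powr_mono2) auto
    also have "\<dots> = \<beta> * c powr \<gamma>2 * \<sigma> powr (g * \<gamma>2)"
      using c \<sigma>0 by (simp add: powr_mult powr_powr)
    finally have "(infdist (x s) F)\<^sup>2 \<le> (\<beta> * c powr \<gamma>2 * \<sigma> powr (g * \<gamma>2))\<^sup>2"
      by (intro power_mono) (auto simp: infdist_nonneg)
    \<comment> \<open>Squaring turns \<sigma> into the energy and leaves the exponent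
      unchanged.\<close>
    also have "\<dots> = K * (path_energy s p) powr (g * \<gamma>2)"
    proof -
      have "\<sigma> * \<sigma> = path_energy s p" using e0 by (simp add: \<sigma>_def)
      moreover have "(\<sigma> powr (g * \<gamma>2))\<^sup>2 = (\<sigma> * \<sigma>) powr (g * \<gamma>2)"
        using \<sigma>0 by (simp only: power2_eq_square powr_mult)
      ultimately show ?thesis by (simp only: K_def power_mult_distrib)
    qed
    also have "\<dots> \<le> K * ((infdist (x s) F)\<^sup>2 - (infdist (x (s + p)) F)\<^sup>2) powr (g * \<gamma>2)"
      using \<open>K > 0\<close> e0 energy g01 exps(2) by (intro mult_left_mono powr_mono2) auto
    finally show ?thesis by (simp add: s_def add.commute)
  qed
  ultimately show ?thesis unfolding g_def by blast
qed

lemma infdist_le_cycle: "infdist (x t) F \<le> infdist (x (t div p * p)) F"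
  by (intro infdist_antimono) simp

text \<open>The square root halves the exponent of \<open>powr_recurrence_rate\<close>; converting
  cycles into single steps costs the constant \<open>real p powr \<rho>\<close>.\<close>

lemma cycle_rate_powr:
  assumes p: "p \<ge> 1" and \<gamma>: "0 < \<gamma>" "\<gamma> < 1" and "K > 0"
    and rec: "\<And>n. (infdist (x (n * p)) F)\<^sup>2
      \<le> K * ((infdist (x (n * p)) F)\<^sup>2 - (infdist (x (Suc n * p)) F)\<^sup>2) powr \<gamma>"
  shows "\<exists>M>0. \<forall>t\<ge>1. infdist (x t) F \<le> M * real t powr (- (\<gamma> / (2 * (1 - \<gamma>))))"
proof -
  define \<rho> where "\<rho> = \<gamma> / (1 - \<gamma>) / 2"
  have \<rho>: "\<rho> > 0" "\<gamma> / (1 - \<gamma>) = \<rho> + \<rho>"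
    using \<gamma> unfolding \<rho>_def by (simp, simp only: field_sum_of_halves)
  have \<rho>_eq: "\<gamma> / (2 * (1 - \<gamma>)) = \<rho>"
    unfolding \<rho>_def by (simp only: divide_divide_eq_left mult.commute)
  have "\<exists>M>0. \<forall>n. (infdist (x (n * p)) F)\<^sup>2 \<le> M * real (Suc n) powr (- (\<gamma> / (1 - \<gamma>)))"
    by (rule powr_recurrence_rate[OF \<open>K > 0\<close> \<gamma>])
      (use rec in \<open>auto intro!: power_mono infdist_antimono simp: infdist_nonneg\<close>)
  then obtain M where M: "M > 0"
      "\<And>n. (infdist (x (n * p)) F)\<^sup>2 \<le> M * real (Suc n) powr (- (\<rho> + \<rho>))"
    unfolding \<rho> by blast
  have "infdist (x t) F \<le> sqrt M * real p powr \<rho> * real t powr (- \<rho>)" if t: "t \<ge> 1" for t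
  proof -
    define n where "n = t div p"
    have "t < Suc n * p" using p by (simp add: n_def dividend_less_div_times add.commute)
    then have tn: "real t \<le> real (Suc n) * real p"
      by (metis less_imp_le of_nat_le_iff of_nat_mult)
    have "infdist (x t) F \<le> infdist (x (n * p)) F"
      unfolding n_def by (rule infdist_le_cycle)
    also have "\<dots> \<le> sqrt (M * real (Suc n) powr (- (\<rho> + \<rho>)))"
      by (intro real_le_rsqrt M)
    also have "\<dots> = sqrt M * real (Suc n) powr (- \<rho>)"
      by (simp add: real_sqrt_mult powr_half_sqrt[symmetric] powr_powr)
    also have "real (Suc n) powr (- \<rho>) \<le> (real t / real p) powr (- \<rho>)"
      using tn t p \<rho> by (intro powr_mono2') (auto simp: field_simps)
    also have "(real t / real p) powr (- \<rho>) = real p powr \<rho> * real t powr (- \<rho>)"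
      using t p by (simp add: powr_divide powr_minus field_simps)
    finally show ?thesis using M by (simp add: mult.assoc)
  qed
  then show ?thesis
    using M p unfolding \<rho>_eq by (intro exI[of _ "sqrt M * real p powr \<rho>"]) auto
qed

lemma cycle_rate_linear:
  assumes p: "p \<ge> 1"
    and rec: "\<And>n. (infdist (x (n * p)) F)\<^sup>2
      \<le> K * ((infdist (x (n * p)) F)\<^sup>2 - (infdist (x (Suc n * p)) F)\<^sup>2)"
  shows "\<exists>M>0. \<exists>r\<in>{0<..<1}. \<forall>t. infdist (x t) F \<le> M * r ^ t"
proof -
  define a where "a n = (infdist (x (n * p)) F)\<^sup>2" for n
  have "\<exists>q\<in>{0<..<1}. \<forall>n. a n \<le> a 0 * q ^ n"
    unfolding a_def by (rule linear_recurrence_rate)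
      (use rec in \<open>auto intro!: power_mono infdist_antimono simp: infdist_nonneg\<close>)
  then obtain q where q: "0 < q" "q < 1" "\<And>n. a n \<le> a 0 * q ^ n" by auto
  \<comment> \<open>The factor \<open>1 / p\<close> spreads the decay of a cycle over its steps, and
    \<open>1 / 2\<close> accounts for the square root.\<close>
  define r where "r = q powr (1 / (2 * real p))"
  \<comment> \<open>Division by \<open>q\<close> pays for an incomplete cycle; adding 1 keeps
    \<open>M\<close> positive if \<open>a 0\<close> vanishes.\<close>
  define M where "M = sqrt (a 0 / q) + 1"
  have r: "r \<in> {0<..<1}"
    using q p powr_less_mono2[of "1 / (2 * real p)" q 1] by (auto simp: r_def)
  have a0: "0 \<le> a 0" by (simp add: a_def)
  have "infdist (x t) F \<le> M * r ^ t" for t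
  proof -
    define n where "n = t div p"
    have "t < Suc n * p" using p by (simp add: n_def dividend_less_div_times add.commute)
    then have "real t \<le> real (Suc n) * real p"
      by (metis less_imp_le of_nat_le_iff of_nat_mult)
    then have tn: "real t / real p \<le> real (Suc n)" using p by (simp add: field_simps)
    have "q * q ^ n = q powr real (Suc n)" using q by (simp only: powr_realpow power_Suc)
    also have "\<dots> \<le> q powr (real t / real p)" using tn q by (intro powr_mono') auto
    also have "\<dots> = (r ^ t)\<^sup>2"
      using q p by (simp add: r_def powr_realpow[symmetric] powr_powr)
    finally have "q ^ n \<le> (r ^ t)\<^sup>2 / q" using q by (simp add: field_simps)
    then have "a 0 * q ^ n \<le> a 0 / q * (r ^ t)\<^sup>2"
      using a0 mult_left_mono by fastforce
    then have "(infdist (x (n * p)) F)\<^sup>2 \<le> a 0 / q * (r ^ t)\<^sup>2"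
      using q(3)[of n] by (simp add: a_def)
    then have "infdist (x (n * p)) F \<le> sqrt (a 0 / q * (r ^ t)\<^sup>2)"
      by (rule real_le_rsqrt)
    also have "\<dots> = sqrt (a 0 / q) * r ^ t"
      using r by (simp only: real_sqrt_mult real_sqrt_abs) simp
    also have "\<dots> \<le> M * r ^ t" using r by (intro mult_right_mono) (auto simp: M_def)
    finally show ?thesis using infdist_le_cycle[of t p] by (simp add: n_def)
  qed
  moreover have "M > 0"
    using a0 q by (simp add: M_def add_nonneg_pos)
  ultimately show ?thesis using r by blast
qed

end

text \<open>Lets the case of exponent 1 also count as a sublinear rate. It holds because
  \<open>real t * r ^ t\<close> tends to 0 and is therefore bounded.\<close>

lemma geometric_le_inverse_linear:
  fixes r :: real
  assumes "r \<in> {0<..<1}"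
  shows "\<exists>M. \<forall>t\<ge>1. r ^ t \<le> M * real t powr (- 1)"
proof -
  have "(\<lambda>t. real t * r ^ t) \<longlonglongrightarrow> 0"
    using assms by (intro powser_times_n_limit_0) auto
  then have "Bseq (\<lambda>t. real t * r ^ t)"
    using convergentI convergent_imp_Bseq by blast
  then obtain M where M: "\<And>t. norm (real t * r ^ t) \<le> M" by (meson BseqE)
  have "r ^ t \<le> M * real t powr (- 1)" if "t \<ge> 1" for t
    using M[of t] that assms by (simp add: powr_minus field_simps)
  then show ?thesis by blast
qed

section \<open>The multiple-sets algorithm as a Fejer sequence\<close>

lemma multiple_sets_DR_step:
  assumes "multiple_sets_DR C p \<Omega> y z x" "p \<ge> 1"
  shows "x (Suc t) = DR_tuple C (\<Omega> (t mod p + 1)) (x t)"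
proof -
  have "t mod p + 1 \<in> {1..p}" using assms(2) by (simp add: Suc_leI)
  moreover have "[t mod p + 1 = t + 1] (mod p)" by (simp add: cong_def mod_Suc_eq)
  ultimately show ?thesis
    using assms(1) unfolding multiple_sets_DR_def
    by (metis DR_op_eq_step DR_tuple_def Suc_eq_plus1)
qed

theorem corollary4p2:
  fixes C :: "nat \<Rightarrow> 'a::{real_inner, complete_space} set"
    and \<Omega> :: "nat \<Rightarrow> nat \<times> nat"
    and m p :: nat
    and x y z :: "nat \<Rightarrow> 'a"
  assumes "m \<ge> 1"
    and "\<And>i. i \<in> {1..m} \<Longrightarrow> closed (C i)"
    and "\<And>i. i \<in> {1..m} \<Longrightarrow> convex (C i)"
    and "(\<Inter>i\<in>{1..m}. C i) \<noteq> {}"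
    and "\<And>j. j \<in> {1..p} \<Longrightarrow>
           \<Omega> j \<in> {(i1, i2). i1 \<in> {1..m} \<and> i2 \<in> {1..m} \<and> i1 \<noteq> i2}"
    and "(\<Union>j\<in>{1..p}. {fst (\<Omega> j), snd (\<Omega> j)}) = {1..m}"
    and "multiple_sets_DR C p \<Omega> y z x"
    and "\<And>j. j \<in> {1..p} \<Longrightarrow> bounded_Holder_regular (DR_tuple C (\<Omega> j))"
    and "bounded_Holder_regular_inter {1..p} (\<lambda>j. Fix (DR_tuple C (\<Omega> j)))"
  shows "\<exists>xbar \<in> (\<Inter>j\<in>{1..p}. Fix (DR_tuple C (\<Omega> j))).
           x \<longlonglongrightarrow> xbar \<and>
           (\<exists>\<rho>>0. \<exists>M. \<forall>t\<ge>1. norm (x t - xbar) \<le> M * real t powr (- \<rho>)) \<and>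
           (\<forall>\<gamma>1 \<gamma>2 \<gamma>.
              (\<forall>j\<in>{1..p}. bounded_Holder_regular_uniform (DR_tuple C (\<Omega> j)) (\<gamma>1 j)) \<longrightarrow>
              bounded_Holder_regular_inter_uniform {1..p} (\<lambda>j. Fix (DR_tuple C (\<Omega> j))) \<gamma>2 \<longrightarrow>
              \<gamma> = Min (\<gamma>1 ` {1..p}) * \<gamma>2 \<longrightarrow>
              (\<exists>M>0. \<exists>r\<in>{0<..<1}. \<forall>t\<ge>1.
                 (\<gamma> \<in> {0<..<1} \<longrightarrow>
                    norm (x t - xbar) \<le> M * real t powr (- (\<gamma> / (2 * (1 - \<gamma>))))) \<and>
                 (\<gamma> = 1 \<longrightarrow> norm (x t - xbar) \<le> M * r ^ t)))"
proof -
  define T where "T j = DR_tuple C (\<Omega> j)" for j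
  define F where "F = (\<Inter>j\<in>{1..p}. Fix (T j))"
  \<comment> \<open>For \<open>p = 0\<close> the tuples would cover no index, against
    \<open>m \<ge> 1\<close>.\<close>
  have p: "p \<ge> 1"
    using assms(1,6) by (cases p) auto
  have \<Omega>: "fst (\<Omega> j) \<in> {1..m}" "snd (\<Omega> j) \<in> {1..m}" if "j \<in> {1..p}" for j
    using assms(5)[OF that] by auto
  have C: "closed (C i)" "convex (C i)" "C i \<noteq> {}" if "i \<in> {1..m}" for i
    using assms(2-4) that by blast+
  have firm: "(norm (T j u - T j v))\<^sup>2 + (norm ((u - T j u) - (v - T j v)))\<^sup>2 \<le> (norm (u - v))\<^sup>2"
    if "j \<in> {1..p}" for j u v
    unfolding T_def DR_tuple_def using \<Omega>[OF that] by (intro DR_op_firmly_nonexpansive C)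
  have "closed (Fix (T j))" if "j \<in> {1..p}" for j
    unfolding T_def DR_tuple_def using \<Omega>[OF that] by (intro closed_Fix_DR_op C)
  then have "closed F" unfolding F_def by blast
  have "(\<Inter>i\<in>{1..m}. C i) \<subseteq> Fix (T j)" if "j \<in> {1..p}" for j
  proof -
    have "C (fst (\<Omega> j)) \<inter> C (snd (\<Omega> j)) \<subseteq> Fix (T j)"
      unfolding T_def DR_tuple_def using \<Omega>[OF that] by (intro Int_subset_Fix_DR_op C)
    then show ?thesis using \<Omega>[OF that] by blast
  qed
  then have "F \<noteq> {}" using assms(4) unfolding F_def by blast
  have iter: "x (Suc t) = T (t mod p + 1) (x t)" for t
    unfolding T_def by (rule multiple_sets_DR_step[OF assms(7) p])
  have idx: "t mod p + 1 \<in> {1..p}" for t using p by (simp add: Suc_leI)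
  interpret fejer_steps x F
  proof
    fix f t assume "f \<in> F"
    then have "T (t mod p + 1) f = f" using idx[of t] unfolding F_def Fix_def by blast
    then show "(dist (x (Suc t)) f)\<^sup>2 + (dist (x (Suc t)) (x t))\<^sup>2 \<le> (dist (x t) f)\<^sup>2"
      using firm[OF idx, of t "x t" f] by (simp add: iter dist_norm norm_minus_commute)
  qed fact
  define cyc where "cyc \<gamma> \<longleftrightarrow> (\<exists>K>0. \<forall>n. (infdist (x (n * p)) F)\<^sup>2
      \<le> K * ((infdist (x (n * p)) F)\<^sup>2 - (infdist (x (Suc n * p)) F)\<^sup>2) powr \<gamma>)" for \<gamma>
  \<comment> \<open>Regularity is applied to the single bounded set \<open>range x\<close>, so the
    uniform and the non-uniform assumptions both feed into this statement.\<close>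
  have recurrence: "cyc (Min (\<gamma>1 ` {1..p}) * \<gamma>2)"
    if exps: "\<And>j. j \<in> {1..p} \<Longrightarrow> \<gamma>1 j \<in> {0<..1}" "\<gamma>2 \<in> {0<..1}"
      and reg: "\<And>j. j \<in> {1..p} \<Longrightarrow> \<exists>\<mu>>0. \<forall>u\<in>range x. infdist u (Fix (T j)) \<le> \<mu> * norm (u - T j u) powr \<gamma>1 j"
      and inter: "\<exists>\<beta>>0. \<forall>u\<in>range x. infdist u F
        \<le> \<beta> * Max ((\<lambda>j. infdist u (Fix (T j))) ` {1..p}) powr \<gamma>2"
    for \<gamma>1 \<gamma>2
  proof -
    obtain \<mu> where \<mu>: "\<And>j. j \<in> {1..p} \<Longrightarrow> \<mu> j > 0"
        "\<And>j t. j \<in> {1..p} \<Longrightarrow> infdist (x t) (Fix (T j)) \<le> \<mu> j * norm (x t - T j (x t)) powr \<gamma>1 j"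
      using reg by (metis rangeI)
    obtain \<beta> where \<beta>: "\<beta> > 0"
        "\<And>t. infdist (x t) F \<le> \<beta> * Max ((\<lambda>j. infdist (x t) (Fix (T j))) ` {1..p}) powr \<gamma>2"
      using inter by blast
    have "infdist (x t) (Fix (T j)) \<le> \<mu> j * dist (x (Suc t)) (x t) powr \<gamma>1 j"
      if "j = t mod p + 1" for t j
      using \<mu>(2)[OF idx, of t t] that by (simp add: iter dist_norm norm_minus_commute)
    then show ?thesis
      unfolding cyc_def by (intro cycle_recurrence[OF p exps \<mu>(1) \<beta>(1) _ \<beta>(2)])
  qed
  have min_pos: "Min (\<gamma>1 ` {1..p}) \<in> {0<..1}"
    if "\<And>j. j \<in> {1..p} \<Longrightarrow> \<gamma>1 j \<in> {0<..1}" for \<gamma>1 :: "nat \<Rightarrow> real"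
  proof -
    have "Min (\<gamma>1 ` {1..p}) \<in> \<gamma>1 ` {1..p}" using p by (intro Min_in) auto
    then obtain j where "j \<in> {1..p}" "Min (\<gamma>1 ` {1..p}) = \<gamma>1 j" by (rule imageE)
    then show ?thesis using that[of j] by simp
  qed
  have rate: "(\<gamma> < 1 \<longrightarrow> (\<exists>M>0. \<forall>t\<ge>1. infdist (x t) F \<le> M * real t powr (- (\<gamma> / (2 * (1 - \<gamma>)))))) \<and>
      (\<gamma> = 1 \<longrightarrow> (\<exists>M>0. \<exists>r\<in>{0<..<1}. \<forall>t. infdist (x t) F \<le> M * r ^ t))"
    if \<gamma>: "0 < \<gamma>" and cyc: "cyc \<gamma>" for \<gamma>
  proof -
    obtain K where K: "K > 0" "\<And>n. (infdist (x (n * p)) F)\<^sup>2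
      \<le> K * ((infdist (x (n * p)) F)\<^sup>2 - (infdist (x (Suc n * p)) F)\<^sup>2) powr \<gamma>"
      using cyc unfolding cyc_def by blast
    \<comment> \<open>For \<gamma> = 1 the \<open>powr\<close> disappears only on nonnegative
      bases.\<close>
    have nonneg: "0 \<le> (infdist (x (n * p)) F)\<^sup>2 - (infdist (x (Suc n * p)) F)\<^sup>2" for n
    proof -
      have "(infdist (x (Suc n * p)) F)\<^sup>2 \<le> (infdist (x (n * p)) F)\<^sup>2"
        by (intro power_mono infdist_antimono infdist_nonneg) simp
      then show ?thesis by linarith
    qed
    show ?thesis
    proof (intro conjI impI)
      assume "\<gamma> < 1"
      then show "\<exists>M>0. \<forall>t\<ge>1. infdist (x t) F \<le> M * real t powr (- (\<gamma> / (2 * (1 - \<gamma>))))"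
        by (rule cycle_rate_powr[OF p \<gamma> _ K])
    next
      assume "\<gamma> = 1"
      then show "\<exists>M>0. \<exists>r\<in>{0<..<1}. \<forall>t. infdist (x t) F \<le> M * r ^ t"
        using cycle_rate_linear[OF p, of K] K(2) nonneg by (simp add: powr_one)
    qed
  qed

  \<comment> \<open>The exponents obtained for \<open>range x\<close> yield some rate. This comes
    first because \<open>xbar\<close> has to be fixed before the uniform exponents are
    introduced.\<close>
  have "\<exists>\<rho>>0. \<exists>M. \<forall>t\<ge>1. infdist (x t) F \<le> M * real t powr (- \<rho>)"
  proof -
    have "\<exists>\<gamma>\<in>{0<..1}. \<exists>\<mu>>0. \<forall>u\<in>range x. infdist u (Fix (T j)) \<le> \<mu> * norm (u - T j u) powr \<gamma>"
      if "j \<in> {1..p}" for j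
      using assms(8)[OF that] bounded_range unfolding bounded_Holder_regular_def T_def by blast
    then obtain \<gamma>1 where \<gamma>1: "\<And>j. j \<in> {1..p} \<Longrightarrow> \<gamma>1 j \<in> {0<..1}"
        "\<And>j. j \<in> {1..p} \<Longrightarrow> \<exists>\<mu>>0. \<forall>u\<in>range x. infdist u (Fix (T j)) \<le> \<mu> * norm (u - T j u) powr \<gamma>1 j"
      by metis
    obtain \<gamma>2 where \<gamma>2: "\<gamma>2 \<in> {0<..1}" "\<exists>\<beta>>0. \<forall>u\<in>range x. infdist u F
        \<le> \<beta> * Max ((\<lambda>j. infdist u (Fix (T j))) ` {1..p}) powr \<gamma>2"
      using assms(9) bounded_range unfolding bounded_Holder_regular_inter_def F_def T_def by blast
    define \<gamma> where "\<gamma> = Min (\<gamma>1 ` {1..p}) * \<gamma>2"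
    have \<gamma>: "0 < \<gamma>" "\<gamma> \<le> 1"
      using min_pos[OF \<gamma>1(1)] \<gamma>2(1) by (auto simp: \<gamma>_def intro!: mult_le_one)
    have "cyc \<gamma>"
      unfolding \<gamma>_def by (rule recurrence[OF \<gamma>1(1) \<gamma>2(1) \<gamma>1(2) \<gamma>2(2)])
    note R = rate[OF \<gamma>(1) this]
    show ?thesis
    proof (cases "\<gamma> < 1")
      case True
      then have "\<gamma> / (2 * (1 - \<gamma>)) > 0" using \<gamma> by simp
      then show ?thesis using R True by blast
    next
      case False
      \<comment> \<open>Here \<gamma> = 1, and the geometric rate is weakened to \<rho> = 1.\<close>
      then obtain M r where M: "M > 0" "r \<in> {0<..<1}" "\<And>t. infdist (x t) F \<le> M * r ^ t"
        using R \<gamma>(2) by force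
      obtain M' where M': "\<And>t. t \<ge> 1 \<Longrightarrow> r ^ t \<le> M' * real t powr (- 1)"
        using geometric_le_inverse_linear[OF M(2)] by blast
      have "infdist (x t) F \<le> (M * M') * real t powr (- 1)" if "t \<ge> 1" for t
        using mult_left_mono[OF M'[OF that], of M] M(1) M(3)[of t] by (simp add: mult.assoc)
      then show ?thesis by (intro exI[of _ 1]) auto
    qed
  qed
  then obtain \<rho> M where \<rho>: "\<rho> > 0" "\<And>t. t \<ge> 1 \<Longrightarrow> infdist (x t) F \<le> M * real t powr (- \<rho>)"
    by blast
  have "(\<lambda>t. infdist (x t) F) \<longlonglongrightarrow> 0"
  proof (rule tendsto_sandwich[where f = "\<lambda>_. 0"])
    have "(\<lambda>t. real t powr (- \<rho>)) \<longlonglongrightarrow> 0"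
      using \<rho>(1) filterlim_real_sequentially by (intro tendsto_neg_powr) auto
    then show "(\<lambda>t. M * real t powr (- \<rho>)) \<longlonglongrightarrow> 0"
      by (rule tendsto_mult_right_zero)
    show "\<forall>\<^sub>F t in sequentially. infdist (x t) F \<le> M * real t powr (- \<rho>)"
      using \<rho>(2) by (auto simp: eventually_sequentially)
  qed (auto simp: infdist_nonneg)
  then obtain xbar where xbar: "xbar \<in> F" "x \<longlonglongrightarrow> xbar"
      "\<And>t. dist (x t) xbar \<le> 2 * infdist (x t) F"
    using fejer_steps_converges[OF fejer_steps_axioms \<open>closed F\<close>] by blast
  have dist_rate: "norm (x t - xbar) \<le> (2 * c) * e" if "infdist (x t) F \<le> c * e" for t c e
    using xbar(3)[of t] that by (simp add: dist_norm)
  have "\<exists>M>0. \<exists>r\<in>{0<..<1}. \<forall>t\<ge>1.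
      (\<gamma> \<in> {0<..<1} \<longrightarrow> norm (x t - xbar) \<le> M * real t powr (- (\<gamma> / (2 * (1 - \<gamma>))))) \<and>
      (\<gamma> = 1 \<longrightarrow> norm (x t - xbar) \<le> M * r ^ t)"
    if reg: "\<forall>j\<in>{1..p}. bounded_Holder_regular_uniform (DR_tuple C (\<Omega> j)) (\<gamma>1 j)"
      and inter: "bounded_Holder_regular_inter_uniform {1..p} (\<lambda>j. Fix (DR_tuple C (\<Omega> j))) \<gamma>2"
      and \<gamma>_eq: "\<gamma> = Min (\<gamma>1 ` {1..p}) * \<gamma>2" for \<gamma>1 \<gamma>2 \<gamma>
  proof -
    have \<gamma>1: "\<gamma>1 j \<in> {0<..1}"
        "\<exists>\<mu>>0. \<forall>u\<in>range x. infdist u (Fix (T j)) \<le> \<mu> * norm (u - T j u) powr \<gamma>1 j"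
      if "j \<in> {1..p}" for j
      using reg that bounded_range unfolding bounded_Holder_regular_uniform_def T_def by blast+
    have \<gamma>2: "\<gamma>2 \<in> {0<..1}" "\<exists>\<beta>>0. \<forall>u\<in>range x. infdist u F
        \<le> \<beta> * Max ((\<lambda>j. infdist u (Fix (T j))) ` {1..p}) powr \<gamma>2"
      using inter bounded_range unfolding bounded_Holder_regular_inter_uniform_def F_def T_def
      by blast+
    have "0 < \<gamma>" using min_pos[OF \<gamma>1(1)] \<gamma>2(1) by (simp add: \<gamma>_eq)
    have "cyc \<gamma>"
      unfolding \<gamma>_eq by (rule recurrence[OF \<gamma>1(1) \<gamma>2(1) \<gamma>1(2) \<gamma>2(2)])
    note R = rate[OF \<open>0 < \<gamma>\<close> this]
    consider "\<gamma> \<in> {0<..<1}" | "\<gamma> = 1" | "\<gamma> \<notin> {0<..<1}" "\<gamma> \<noteq> 1" by blast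
    then show ?thesis
    proof cases
      case 1
      then obtain M where M: "M > 0"
          "\<And>t. t \<ge> 1 \<Longrightarrow> infdist (x t) F \<le> M * real t powr (- (\<gamma> / (2 * (1 - \<gamma>))))"
        using R by auto
      show ?thesis
        using M(1) dist_rate[OF M(2)] 1
        \<comment> \<open>The factor 2 comes from \<open>dist_rate\<close>; any \<open>r\<close> in
          the interval would serve in this case.\<close>
        by (intro exI[of _ "2 * M"] conjI bexI[of _ "1/2"] allI impI) auto
    next
      case 2
      then obtain M r where M: "M > 0" "r \<in> {0<..<1}" "\<And>t. infdist (x t) F \<le> M * r ^ t"
        using R by auto
      show ?thesis
        using M(1,2) dist_rate[OF M(3)] 2
        by (intro exI[of _ "2 * M"] conjI bexI[of _ r] allI impI) auto
    next
      case 3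
      then show ?thesis by (intro exI[of _ 1] conjI bexI[of _ "1/2"]) auto
    qed
  qed
  moreover have "\<exists>\<rho>>0. \<exists>M. \<forall>t\<ge>1. norm (x t - xbar) \<le> M * real t powr (- \<rho>)"
    using \<rho>(1) dist_rate[OF \<rho>(2)] by blast
  ultimately show ?thesis
    using xbar(1,2) unfolding F_def T_def by (intro bexI[of _ xbar] conjI) blast+
qed

end
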